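(* For every integer $k\geq 2$ there exist infinitely many $(2k+1)$-ordered simple graphs $G$ such that, writing $n$ for the number of vertices of $G$, the diameter of $G$ equals $\left\lfloor \frac{n-3}{2k}\right\rfloor+1$.
   Context: A simple graph $G$ is $r$-ordered if, for every sequence $v_1, \ldots, v_r$ of $r$ distinct vertices of $G$, there exists a cycle in $G$ containing $v_1, \ldots, v_r$ in this (cyclic) order. *)

theory Defs
  imports "Graph_Theory.Graph_Theory" "HOL-Library.Sublist"
begin

text \<open>
  A finite simple graph is a \<^const>\<open>pair_graph\<close>: a finite loop-free symmetric digraph whose arcs
  are pairs of vertices, each undirected edge being represented by its two orientations.
\<close>

context pre_digraph
begin

text \<open>
  The length bound excludes \<open>u, v, u\<close>, which traverses a single edge back and forth and is a
  \<^const>\<open>cycle\<close> of the symmetric digraph but not a cycle of the simple graph.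
\<close>
definition simple_cycle :: "'b awalk \<Rightarrow> bool" where
  "simple_cycle p \<longleftrightarrow> cycle p \<and> 3 \<le> length p"

text \<open>
  The tails of the arcs of a cycle list each of its vertices once, in the order of traversal.
  The rotation makes the order cyclic; the reverse orientation needs no separate mention,
  since reversing a cycle of a symmetric digraph yields another of its cycles.
\<close>
definition visits_in_order :: "'b awalk \<Rightarrow> 'a list \<Rightarrow> bool" where
  "visits_in_order p vs \<longleftrightarrow> (\<exists>m. subseq vs (rotate m (map (tail G) p)))"

definition r_ordered :: "nat \<Rightarrow> bool" where
  "r_ordered r \<longleftrightarrow> (\<forall>vs. length vs = r \<and> distinct vs \<and> set vs \<subseteq> verts G \<longrightarrow>
     (\<exists>p. simple_cycle p \<and> visits_in_order p vs))"

end

context wf_digraph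
begin

text \<open>The distance is the cost of a shortest walk for unit weights; it is \<open>\<infinity>\<close> between vertices in
  different components.\<close>
definition diameter :: ereal where
  "diameter = (SUP u\<in>verts G. SUP v\<in>verts G. \<mu> (\<lambda>_. 1) u v)"

end

end

theory Submission
  imports Defs
begin

text \<open>
  Stack cliques of \<open>2k\<close> vertices each (the last one a single vertex) into consecutive layers and
  join consecutive layers completely; the diameter is the number of the last layer. Given
  \<open>2k + 1\<close> vertices, run from each to the next monotonically through the layers, spending one new
  vertex on every layer that is strictly crossed. If \<open>m\<close> of the given vertices lie in a layer,
  \<open>1 \<le> m \<le> 2k\<close>, then at least \<open>m + 1\<close> of the \<open>2k + 1\<close> segments have an end in it, so at most
  \<open>2k - m\<close> segments cross it. If \<open>m = 0\<close>, the number of crossings is even, hence at most \<open>2k\<close>.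
  Either way the layer has enough vertices.
\<close>

section \<open>Counting the segments that cross a layer\<close>

definition crosses :: "nat \<Rightarrow> nat \<Rightarrow> nat \<Rightarrow> bool" where
  "crosses i a b \<longleftrightarrow> a < i \<and> i < b \<or> b < i \<and> i < a"

text \<open>If the bound failed, the disjoint index sets of crossings and of visits to
  \<open>i\<close> would exhaust all 2k + 1 indices, so every segment starting off \<open>i\<close>
  would cross it. By \<open>few\<close> some segment does start off \<open>i\<close>; going round,
  all of them do, and an odd number of changes of side cannot close up.\<close>

lemma card_crossings_bound:
  fixes a :: "nat \<Rightarrow> nat"
  assumes closed: "a (2 * k + 1) = a 0"
    and few: "card {j. j < 2 * k + 1 \<and> a j = i} \<le> 2 * k"
  shows "card {j. j < 2 * k + 1 \<and> crosses i (a j) (a (Suc j))}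
    + card {j. j < 2 * k + 1 \<and> a j = i} \<le> 2 * k"
proof (rule ccontr)
  let ?C = "{j. j < 2 * k + 1 \<and> crosses i (a j) (a (Suc j))}"
  let ?M = "{j. j < 2 * k + 1 \<and> a j = i}"
  assume neg: "\<not> ?thesis"
  have "card (?C \<union> ?M) = card ?C + card ?M"
    by (rule card_Un_disjoint) (auto simp: crosses_def)
  with neg have "card {..<2 * k + 1} \<le> card (?C \<union> ?M)" by simp
  then have eq: "?C \<union> ?M = {..<2 * k + 1}"
    by (intro card_seteq) auto
  have cross: "crosses i (a j) (a (Suc j))" if "j < 2 * k + 1" "a j \<noteq> i" for j
  proof -
    have "j \<in> ?C \<union> ?M" using that eq by blast
    then show ?thesis using that by blast
  qed
  \<comment> \<open>A crossing also ends off \<open>i\<close>, so being off \<open>i\<close> passes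
    on to all later indices.\<close>
  have propagate: "a (j + l) \<noteq> i" if "a j \<noteq> i" "j + l \<le> 2 * k + 1" for j l
    using that
  proof (induction l)
    case (Suc l)
    then show ?case using cross[of "j + l"] by (auto simp: crosses_def)
  qed simp
  have "?M \<noteq> {..<2 * k + 1}"
  proof
    assume "?M = {..<2 * k + 1}"
    then have "card ?M = 2 * k + 1" by (simp only: card_lessThan)
    with few show False by linarith
  qed
  then obtain j where j: "j < 2 * k + 1" "a j \<noteq> i" by blast
  then have "a 0 \<noteq> i" using propagate[of j "2 * k + 1 - j"] closed by simp
  then have off: "a l \<noteq> i" if "l \<le> 2 * k + 1" for l
    using propagate[of 0 l] that by simp
  have "a l < i \<longleftrightarrow> (a 0 < i \<longleftrightarrow> even l)" if "l \<le> 2 * k + 1" for l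
    using that
  proof (induction l)
    case (Suc l)
    then show ?case using cross[of l] off[of l] by (auto simp: crosses_def)
  qed simp
  from this[of "2 * k + 1"] closed show False by simp
qed

section \<open>Monotone runs through the layers and their concatenation\<close>

definition layers_between :: "nat \<Rightarrow> nat \<Rightarrow> nat list" where
  "layers_between a b = (if a \<le> b then [Suc a..<b] else rev [Suc b..<a])"

lemma set_layers_between: "set (layers_between a b) = {i. crosses i a b}"
  by (auto simp: layers_between_def crosses_def)

lemma distinct_layers_between: "distinct (layers_between a b)"
  by (simp add: layers_between_def)

abbreviation near :: "nat \<Rightarrow> nat \<Rightarrow> bool" where
  "near a b \<equiv> a \<le> Suc b \<and> b \<le> Suc a"

lemma successively_near_upt: "successively near [a..<b]"
  by (auto simp: successively_conv_nth)

lemma successively_layers_between: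
  "successively near (a # layers_between a b @ [b])"
proof -
  consider "a < b" | "b < a" | "a = b" by linarith
  then show ?thesis
  proof cases
    case 1
    then have "a # layers_between a b @ [b] = [a..<Suc b]"
      by (simp add: layers_between_def upt_conv_Cons)
    then show ?thesis using successively_near_upt by presburger
  next
    case 2
    then have "a # layers_between a b @ [b] = rev [b..<Suc a]"
      by (simp add: layers_between_def upt_conv_Cons)
    moreover have "successively near (rev [b..<Suc a])"
      unfolding successively_rev by (rule successively_mono[OF successively_near_upt]) auto
    ultimately show ?thesis by presburger
  next
    case 3
    then show ?thesis by (simp add: layers_between_def)
  qed
qed

text \<open>Each block omits its end because the next block begins with it; the appended
  \<open>v n\<close> ends the last one. With \<open>v n = v 0\<close> this is adjacency around a
  closed list.\<close>

lemma successively_concat_blocks: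
  assumes "\<And>j. j < n \<Longrightarrow> successively P (v j # g j @ [v (Suc j)])"
  shows "successively P (concat (map (\<lambda>j. v j # g j) [0..<n]) @ [v n])"
  using assms
proof (induction n)
  case (Suc n)
  then have 1: "successively P (concat (map (\<lambda>j. v j # g j) [0..<n]) @ [v n])"
    and 2: "successively P (v n # g n @ [v (Suc n)])" by auto
  from 1 2 show ?case
    by (auto simp: successively_append_iff successively_Cons)
qed simp

lemma subseq_concat_blocks: "subseq (map v js) (concat (map (\<lambda>j. v j # g j) js))"
  by (induction js) auto

section \<open>From vertex lists to cycles of arcs\<close>

lemma awalk_of_vertex_list:
  assumes "x \<in> pverts G" "successively (\<lambda>x y. (x, y) \<in> parcs G) (x # xs)"
  shows "pre_digraph.awalk (with_proj G) x (zip (x # xs) xs) (last (x # xs))"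
proof -
  have "set (zip (x # xs) xs) \<subseteq> parcs G \<and> pcas x (zip (x # xs) xs) (last (x # xs))"
    using assms(2) by (induction xs arbitrary: x) auto
  then show ?thesis
    using assms(1) by (simp add: pre_digraph.awalk_def cas_with_proj_eq)
qed

lemma pawalk_verts_of_vertex_list:
  "xs \<noteq> [] \<Longrightarrow> pawalk_verts u (zip (x # xs) xs) = x # xs"
proof (induction xs arbitrary: u x)
  case (Cons y xs)
  then show ?case by (cases "xs = []") auto
qed simp

text \<open>Pairing each vertex with its cyclic successor makes the tails of the arcs spell out
  \<open>ws\<close> itself, which is the list that \<open>visits_in_order\<close> inspects.\<close>

lemma simple_cycle_of_vertex_list:
  assumes "distinct ws" "3 \<le> length ws" "set ws \<subseteq> pverts G"
    and "successively (\<lambda>x y. (x, y) \<in> parcs G) (ws @ [hd ws])"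
  shows "pre_digraph.simple_cycle (with_proj G) (zip ws (tl ws @ [hd ws]))"
proof -
  obtain x xs where ws: "ws = x # xs" using assms(2) by (cases ws) auto
  have z: "zip ws (tl ws @ [hd ws]) = zip (x # xs @ [x]) (xs @ [x])"
    using zip_append1[of "x # xs" "[x]" "xs @ [x]"] by (simp add: ws)
  have "pre_digraph.awalk (with_proj G) x (zip ws (tl ws @ [hd ws])) x"
    unfolding z using awalk_of_vertex_list[of x G "xs @ [x]"] assms(3,4) by (simp add: ws)
  moreover have "distinct (tl (pawalk_verts x (zip ws (tl ws @ [hd ws]))))"
    unfolding z using assms(1) pawalk_verts_of_vertex_list[of "xs @ [x]" x x] by (simp add: ws)
  ultimately show ?thesis
    using assms(2)
    by (auto simp: pre_digraph.simple_cycle_def pre_digraph.cycle_def awalk_verts_with_proj_eq ws)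
qed

section \<open>The graph of stacked cliques\<close>

definition layered_graph :: "nat \<Rightarrow> nat \<Rightarrow> nat pair_pre_digraph" where
  "layered_graph q d = \<lparr> pverts = {..q * d},
     parcs = {(u, v). u \<le> q * d \<and> v \<le> q * d \<and> u \<noteq> v \<and> near (u div q) (v div q)} \<rparr>"

lemma pverts_layered_graph [simp]: "pverts (layered_graph q d) = {..q * d}"
  by (simp add: layered_graph_def)

lemma in_parcs_layered_graph [simp]:
  "(u, v) \<in> parcs (layered_graph q d) \<longleftrightarrow>
    u \<le> q * d \<and> v \<le> q * d \<and> u \<noteq> v \<and> near (u div q) (v div q)"
  by (simp add: layered_graph_def)

lemma pair_graph_layered_graph: "pair_graph (layered_graph q d)"
proof
  have "parcs (layered_graph q d) \<subseteq> {..q * d} \<times> {..q * d}" by auto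
  then show "finite (parcs (layered_graph q d))"
    by (rule finite_subset) simp
  show "symmetric (with_proj (layered_graph q d))"
    unfolding symmetric_def by (rule symI) auto
qed auto

text \<open>Below layer \<open>d\<close> the cut-off at \<open>q * d\<close> removes nothing, so
  these layers have all \<open>q\<close> vertices; layer \<open>d\<close> is just the vertex
  \<open>q * d\<close>.\<close>

lemma layer_atMost:
  fixes q i d :: nat
  assumes "0 < q" "i < d"
  shows "{u. u \<le> q * d \<and> u div q = i} = {q * i..<q * i + q}"
proof -
  have le: "q * i + q \<le> q * d" using mult_le_mono2[of "Suc i" d q] assms by simp
  have "u div q = i \<longleftrightarrow> q * i \<le> u \<and> u < q * i + q" for u
  proof
    assume "u div q = i"
    then show "q * i \<le> u \<and> u < q * i + q"
      using mult_div_mod_eq[of q u] mod_less_divisor[OF assms(1), of u] by auto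
  qed (auto intro!: div_nat_eqI simp: mult.commute)
  then show ?thesis
    using le by (intro set_eqI) (simp only: mem_Collect_eq atLeastLessThan_iff, linarith)
qed

section \<open>A cycle through 2k + 1 given vertices in order\<close>

lemma r_ordered_layered_graph:
  assumes k: "1 \<le> k"
  shows "pre_digraph.r_ordered (with_proj (layered_graph (2 * k) d)) (2 * k + 1)"
  unfolding pre_digraph.r_ordered_def
proof (intro allI impI, elim conjE)
  fix vs :: "nat list"
  let ?q = "2 * k" and ?r = "2 * k + 1"
  let ?G = "layered_graph ?q d"
  assume len: "length vs = ?r" and dist: "distinct vs"
    and "set vs \<subseteq> verts (with_proj ?G)"
  then have sub: "set vs \<subseteq> {..?q * d}" by simp
  \<comment> \<open>Indices are read modulo 2k + 1, so the last segment returns to the first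
    vertex.\<close>
  define v where "v j = vs ! (j mod ?r)" for j
  define a where "a j = v j div ?q" for j
  have v_closed: "v ?r = v 0" by (simp add: v_def)
  have v_mem: "v j \<in> set vs" for j
    using len by (simp add: v_def)
  have vs_eq: "vs = map v [0..<?r]"
    using len by (intro nth_equalityI) (simp_all add: v_def del: upt_Suc)
  have v_inj: "v j = v j' \<longleftrightarrow> j = j'" if "j < ?r" "j' < ?r" for j j'
    using that len dist by (simp add: v_def nth_eq_iff_index_eq)
  have a_le: "a j \<le> d" for j
  proof -
    have "v j \<le> ?q * d" using v_mem sub by auto
    then have "v j div ?q \<le> ?q * d div ?q" by (rule div_le_mono)
    then show ?thesis using k by (simp add: a_def)
  qed
  define L where "L i = {u. u \<le> ?q * d \<and> u div ?q = i}" for i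
  define C where "C i = {j. j < ?r \<and> crosses i (a j) (a (Suc j))}" for i
  \<comment> \<open>Each segment crossing layer \<open>i\<close> is to receive its own vertex there,
    outside \<open>vs\<close>; such an injection exists by comparing cardinalities.\<close>
  have "\<exists>f. f ` C i \<subseteq> L i - set vs \<and> inj_on f (C i)" for i
  proof (cases "C i = {}")
    case False
    \<comment> \<open>A crossed layer lies strictly below another one, so it is never the one-vertex
      layer \<open>d\<close>.\<close>
    then have "i < d"
      using a_le by (auto simp: C_def crosses_def intro: less_le_trans)
    let ?M = "{j. j < ?r \<and> a j = i}"
    have "v ` ?M = L i \<inter> set vs"
    proof
      show "v ` ?M \<subseteq> L i \<inter> set vs" using v_mem sub by (auto simp: L_def a_def)
      show "L i \<inter> set vs \<subseteq> v ` ?M"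
        unfolding vs_eq by (auto simp: L_def a_def simp del: upt_Suc)
    qed
    moreover have "inj_on v ?M" using v_inj by (auto simp: inj_on_def)
    ultimately have M: "card ?M = card (L i \<inter> set vs)"
      by (metis card_image)
    have L: "finite (L i)" "card (L i) = ?q"
      using k \<open>i < d\<close> by (simp_all add: L_def layer_atMost)
    have "card (L i \<inter> set vs) \<le> ?q"
      using L by (metis card_mono inf_le1)
    then have "card (C i) + card (L i \<inter> set vs) \<le> ?q"
      using card_crossings_bound[of a k i] v_closed M by (simp add: C_def a_def)
    then have "card (C i) \<le> card (L i - set vs)"
      using L by (simp add: card_Diff_subset_Int)
    moreover have "finite (C i)" by (simp add: C_def)
    ultimately show ?thesis using L by (intro card_le_inj) auto
  qed auto
  then obtain f where f: "\<And>i. f i ` C i \<subseteq> L i - set vs" "\<And>i. inj_on (f i) (C i)"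
    by metis
  \<comment> \<open>The interior of segment \<open>j\<close>: its reserved vertex in each crossed
    layer, in order of travel.\<close>
  define g where "g j = map (\<lambda>i. f i j) (layers_between (a j) (a (Suc j)))" for j
  have f_layer: "f i j \<le> ?q * d \<and> f i j div ?q = i \<and> f i j \<notin> set vs"
    if "j < ?r" "crosses i (a j) (a (Suc j))" for i j
    using f(1)[of i] that by (auto simp: L_def C_def)
  have g_mem: "\<exists>i. u = f i j \<and> crosses i (a j) (a (Suc j))" if "u \<in> set (g j)" for u j
    using that by (auto simp: g_def set_layers_between)
  have g_distinct: "distinct (g j)" if "j < ?r" for j
    unfolding g_def distinct_map using f_layer[OF that]
    by (auto simp: distinct_layers_between set_layers_between inj_on_def) metis
  \<comment> \<open>A common vertex determines its layer, and injectivity of the choice in that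
    layer determines the segment.\<close>
  have g_disjoint: "j = j'" if j: "j < ?r" "j' < ?r" and u: "u \<in> set (g j)" "u \<in> set (g j')" for j j' u
  proof -
    obtain i where i: "u = f i j" "crosses i (a j) (a (Suc j))"
      using g_mem[OF u(1)] by blast
    obtain i' where i': "u = f i' j'" "crosses i' (a j') (a (Suc j'))"
      using g_mem[OF u(2)] by blast
    have "i = i'" using f_layer[OF j(1) i(2)] f_layer[OF j(2) i'(2)] i(1) i'(1) by simp
    then show ?thesis using f(2)[of i] i i' j by (auto simp: inj_on_def C_def)
  qed
  have g_vs: "u \<notin> set vs \<and> u \<le> ?q * d" if "j < ?r" "u \<in> set (g j)" for j u
    using g_mem[OF that(2)] f_layer that(1) by blast
  define ws where "ws = concat (map (\<lambda>j. v j # g j) [0..<?r])"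
  have ws_hd: "hd ws = v 0" and ws_ne: "ws \<noteq> []"
    by (simp_all add: ws_def upt_conv_Cons del: upt_Suc)
  have sub_ws: "subseq vs ws"
    using subseq_concat_blocks[of v "[0..<?r]" g] unfolding ws_def vs_eq[symmetric] .
  then have len_ws: "3 \<le> length ws"
    using k len list_emb_length[of "(=)" vs ws] by simp
  have dist_ws: "distinct ws"
    unfolding ws_def
  proof (rule distinct_concat)
    show "distinct (map (\<lambda>j. v j # g j) [0..<?r])"
      using v_inj by (auto simp: distinct_map inj_on_def simp del: upt_Suc)
  next
    fix ys assume "ys \<in> set (map (\<lambda>j. v j # g j) [0..<?r])"
    then obtain j where "j < ?r" "ys = v j # g j" by (auto simp del: upt_Suc)
    then show "distinct ys"
      using g_distinct[of j] g_vs[of j "v j"] v_mem[of j] by auto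
  next
    fix ys zs
    assume ys: "ys \<in> set (map (\<lambda>j. v j # g j) [0..<?r])"
      and zs: "zs \<in> set (map (\<lambda>j. v j # g j) [0..<?r])" and "ys \<noteq> zs"
    from ys obtain j where "j < ?r" "ys = v j # g j" by (auto simp del: upt_Suc)
    moreover from zs obtain j' where "j' < ?r" "zs = v j' # g j'" by (auto simp del: upt_Suc)
    moreover from calculation \<open>ys \<noteq> zs\<close> have "j \<noteq> j'" by blast
    ultimately show "set ys \<inter> set zs = {}"
      using v_inj[of j j'] g_disjoint[of j j'] g_vs[of j] g_vs[of j'] v_mem by auto
  qed
  have set_ws: "set ws \<subseteq> {..?q * d}"
    using g_vs v_mem sub by (auto simp: ws_def simp del: upt_Suc)
  have "successively (\<lambda>x y. near (x div ?q) (y div ?q)) (v j # g j @ [v (Suc j)])" if "j < ?r" for j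
  proof -
    have "map (\<lambda>u. u div ?q) (g j) = layers_between (a j) (a (Suc j))"
      using f_layer[OF that] by (auto simp: g_def set_layers_between intro!: map_idI)
    then have "map (\<lambda>u. u div ?q) (v j # g j @ [v (Suc j)])
        = a j # layers_between (a j) (a (Suc j)) @ [a (Suc j)]"
      by (simp add: a_def)
    then show ?thesis
      using successively_layers_between[of "a j" "a (Suc j)"]
        successively_map[of near "\<lambda>u. u div ?q" "v j # g j @ [v (Suc j)]"] by presburger
  qed
  from successively_concat_blocks[of ?r _ v g, OF this]
  have near_ws: "successively (\<lambda>x y. near (x div ?q) (y div ?q)) (ws @ [hd ws])"
    unfolding ws_def[symmetric] v_closed ws_hd .
  have "successively (\<lambda>x y. (x, y) \<in> parcs ?G) (ws @ [hd ws])"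
    unfolding successively_conv_nth
  proof (intro allI impI)
    fix i assume i: "Suc i < length (ws @ [hd ws])"
    \<comment> \<open>Nearness of layers allows equal vertices, but arcs do not. Distinctness of
      \<open>ws\<close> settles this, also at the closing step, as \<open>ws\<close> has more than
      one entry.\<close>
    have "(ws @ [hd ws]) ! i \<noteq> (ws @ [hd ws]) ! Suc i"
      using i dist_ws len_ws ws_ne
      by (auto simp: nth_append hd_conv_nth nth_eq_iff_index_eq)
    moreover have "set (ws @ [hd ws]) \<subseteq> {..?q * d}" using set_ws hd_in_set[OF ws_ne] by auto
    then have "(ws @ [hd ws]) ! i \<le> ?q * d" "(ws @ [hd ws]) ! Suc i \<le> ?q * d"
      using i nth_mem[of i "ws @ [hd ws]"] nth_mem[OF i] by auto
    ultimately show "((ws @ [hd ws]) ! i, (ws @ [hd ws]) ! Suc i) \<in> parcs ?G"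
      using successively_nth[OF near_ws i] by simp
  qed
  then have "pre_digraph.simple_cycle (with_proj ?G) (zip ws (tl ws @ [hd ws]))"
    using dist_ws len_ws set_ws by (intro simple_cycle_of_vertex_list) simp_all
  moreover have "map fst (zip ws (tl ws @ [hd ws])) = ws"
    using ws_ne by simp
  then have "pre_digraph.visits_in_order (with_proj ?G) (zip ws (tl ws @ [hd ws])) vs"
    unfolding pre_digraph.visits_in_order_def
    using sub_ws by (intro exI[of _ 0]) simp
  ultimately show "\<exists>p. pre_digraph.simple_cycle (with_proj ?G) p \<and>
      pre_digraph.visits_in_order (with_proj ?G) p vs" by blast
qed

section \<open>The diameter of the layered graph\<close>

lemma diameter_layered_graph:
  assumes q: "0 < q" and d: "1 \<le> d"
  shows "wf_digraph.diameter (with_proj (layered_graph q d)) = ereal (real d)"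
proof -
  interpret G: pair_graph "layered_graph q d" by (rule pair_graph_layered_graph)
  have cost: "G.awalk_cost (\<lambda>_. 1) p = real (length p)" for p
    by (induction p) auto
  have step: "G.awalk u [(u, v)] v" if "u \<le> q * d" "v \<le> q * d" "u \<noteq> v" "near (u div q) (v div q)" for u v
    using that by (simp add: G.awalk_def)
  \<comment> \<open>The induction starts at length 1, not 0, because distinct vertices of one layer
    are still one step apart.\<close>
  have short: "\<exists>p. G.awalk u p v \<and> length p \<le> Suc n"
    if "u \<le> q * d" "v \<le> q * d" "u div q \<le> v div q + Suc n" "v div q \<le> u div q + Suc n" for u v n
    using that
  proof (induction n arbitrary: u)
    case 0
    show ?case
    proof (cases "u = v")
      case True
      then have "G.awalk u [] v" using 0 by (simp add: G.awalk_def)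
      then show ?thesis by force
    next
      case False
      then have "G.awalk u [(u, v)] v" using 0 by (intro step) auto
      then show ?thesis by force
    qed
  next
    case (Suc n)
    \<comment> \<open>If the layers are too far apart, \<open>w\<close> is the first vertex of the
      next layer towards \<open>v\<close>; otherwise \<open>w = u\<close> and no step is
      made.\<close>
    have "\<exists>w. w \<le> q * d \<and> near (u div q) (w div q) \<and>
        w div q \<le> v div q + Suc n \<and> v div q \<le> w div q + Suc n"
    proof -
      consider "u div q + Suc n < v div q" | "v div q + Suc n < u div q"
        | "u div q \<le> v div q + Suc n" "v div q \<le> u div q + Suc n" by linarith
      then show ?thesis
      proof cases
        case 1
        have "v div q * q \<le> v" by simp
        moreover have "(u div q + 1) * q \<le> v div q * q" using 1 by (intro mult_le_mono1) simp
        ultimately have "(u div q + 1) * q \<le> q * d" using Suc.prems by linarith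
        then show ?thesis
          using 1 Suc.prems q by (intro exI[of _ "(u div q + 1) * q"]) simp
      next
        case 2
        have "u div q * q \<le> u" by simp
        moreover have "(u div q - 1) * q \<le> u div q * q" by (intro mult_le_mono1) simp
        ultimately have "(u div q - 1) * q \<le> q * d" using Suc.prems by linarith
        then show ?thesis
          using 2 Suc.prems q by (intro exI[of _ "(u div q - 1) * q"]) auto
      next
        case 3
        then show ?thesis using Suc.prems by (intro exI[of _ u]) simp
      qed
    qed
    then obtain w where w: "w \<le> q * d" "near (u div q) (w div q)"
      "w div q \<le> v div q + Suc n" "v div q \<le> w div q + Suc n" by blast
    with Suc.IH[of w] Suc.prems obtain p where p: "G.awalk w p v" "length p \<le> Suc n" by blast
    show ?case
    proof (cases "u = w")
      case True
      then show ?thesis using p by (intro exI[of _ p]) simp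
    next
      case False
      then have "G.awalk u ([(u, w)] @ p) v"
        using p(1) w Suc.prems by (intro G.awalk_appendI[OF step]) auto
      then show ?thesis using p(2) by (intro exI[of _ "[(u, w)] @ p"]) simp
    qed
  qed
  have layer_le: "u div q \<le> d" if "u \<le> q * d" for u
    using div_le_mono[OF that, of q] q by simp
  have "G.\<mu> (\<lambda>_. 1) u v \<le> ereal (real d)" if "u \<le> q * d" "v \<le> q * d" for u v
  proof -
    have "\<exists>p. G.awalk u p v \<and> length p \<le> Suc (d - 1)"
      using that d layer_le[of u] layer_le[of v] by (intro short) auto
    then obtain p where "G.awalk u p v" "length p \<le> d" using d by auto
    then show ?thesis
      using G.min_cost_le_walk_cost[of u p v "\<lambda>_. 1"] by (simp add: cost order_trans)
  qed
  then have upper: "G.diameter \<le> ereal (real d)"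
    unfolding G.diameter_def by (intro SUP_least) simp
  \<comment> \<open>An arc climbs at most one layer, so a walk from vertex 0 in layer 0 to
    \<open>q * d\<close> in layer \<open>d\<close> has at least \<open>d\<close> arcs.\<close>
  have walk: "v div q \<le> u div q + length p" if "G.awalk u p v" for u p v
    using that
  proof (induction p arbitrary: u)
    case (Cons e p)
    then show ?case by (cases e) (fastforce simp: G.awalk_Cons_iff)
  qed (simp add: G.awalk_Nil_iff)
  have "ereal (real d) \<le> G.\<mu> (\<lambda>_. 1) 0 (q * d)"
    unfolding G.\<mu>_def using walk[of 0 _ "q * d"] q by (intro INF_greatest) (auto simp: cost)
  also have "\<dots> \<le> G.diameter"
    unfolding G.diameter_def by (intro SUP_upper2[of 0] SUP_upper) simp_all
  finally show ?thesis using upper by (intro antisym)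
qed

section \<open>The infinite family and the diameter formula\<close>

lemma digraph_iso_card_verts:
  assumes "digraph_iso G H"
  shows "card (verts G) = card (verts H)"
  using assms
  by (auto simp: digraph_iso_def pre_digraph.digraph_isomorphism_def card_image)

theorem theorem3p3:
  fixes k :: nat
  assumes "k \<ge> 2"
  shows "\<exists>S :: nat pair_pre_digraph set. infinite S \<and>
    pairwise (\<lambda>G H. \<not> digraph_iso (with_proj G) (with_proj H)) S \<and>
    (\<forall>G\<in>S. pair_graph G \<and>
       pre_digraph.r_ordered (with_proj G) (2 * k + 1) \<and>
       wf_digraph.diameter (with_proj G) =
         ereal (of_int (\<lfloor>(real (card (pverts G)) - 3) / (2 * real k)\<rfloor> + 1)))"
proof (intro exI conjI)
  let ?S = "layered_graph (2 * k) ` {1..}"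
  \<comment> \<open>The number of vertices, 2kd + 1, is invariant under isomorphism and determines
    \<open>d\<close>.\<close>
  have iso: "d = d'"
    if "digraph_iso (with_proj (layered_graph (2 * k) d)) (with_proj (layered_graph (2 * k) d'))"
    for d d'
    using digraph_iso_card_verts[OF that] assms by simp
  have "inj (layered_graph (2 * k))"
  proof (rule injI)
    fix d d' assume "layered_graph (2 * k) d = layered_graph (2 * k) d'"
    then have "pverts (layered_graph (2 * k) d) = pverts (layered_graph (2 * k) d')" by (rule arg_cong)
    then show "d = d'" using assms by simp
  qed
  then show "infinite ?S"
    by (metis finite_imageD infinite_Ici inj_on_subset subset_UNIV)
  show "pairwise (\<lambda>G H. \<not> digraph_iso (with_proj G) (with_proj H)) ?S"
    using iso by (auto simp: pairwise_def)
  have "real_of_int (\<lfloor>(real (card (pverts (layered_graph (2 * k) d))) - 3) / (2 * real k)\<rfloor> + 1)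
      = real d"
    if "1 \<le> d" for d
  proof -
    \<comment> \<open>With n = 2kd + 1 the quotient is d - 1/k, which lies in [d - 1, d).\<close>
    have "\<lfloor>(real (card (pverts (layered_graph (2 * k) d))) - 3) / (2 * real k)\<rfloor> = int d - 1"
      using assms by (intro floor_unique) (simp_all add: field_simps)
    then show ?thesis by simp
  qed
  then show "\<forall>G\<in>?S. pair_graph G \<and>
       pre_digraph.r_ordered (with_proj G) (2 * k + 1) \<and>
       wf_digraph.diameter (with_proj G) =
         ereal (of_int (\<lfloor>(real (card (pverts G)) - 3) / (2 * real k)\<rfloor> + 1))"
    using assms pair_graph_layered_graph r_ordered_layered_graph[of k]
      diameter_layered_graph[of "2 * k"]
    by (auto simp del: pverts_layered_graph of_int_add)
qed

end
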